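(* Let $p$ be a prime, $R\ge 1$ an integer, $V=\mathbb{F}_{p^R}$, and let $k\ge 2$ be an integer dividing $p^R-1$ such that $\frac{p^R-1}{k}$ is even whenever $p$ is odd. Let $\omega$ be a primitive element of $\mathbb{F}_{p^R}$ and $S=\{\omega^{jk} : j\ge 0\}$. Suppose the generalised Paley graph $\Gamma=\mathrm{GPaley}(p^R,\frac{p^R-1}{k})=\mathrm{Cay}(V,S)$ is disconnected. Then $S$ is contained in a proper subfield $\mathbb{F}_{p^a}$ of $V$ (where $a$ is a proper divisor of $R$), and each connected component of $\Gamma$ is isomorphic to $\mathrm{GPaley}(p^a,\frac{p^a-1}{k'})=\mathrm{Cay}(\mathbb{F}_{p^a},S)$, where $k=\frac{p^R-1}{p^a-1}\cdot k'$.
   Context: For a finite field $V=\mathbb{F}_q$ ($q=p^R$), an integer $k\ge2$ with $k\mid q-1$ and $\frac{q-1}{k}$ even if $p$ is odd, and a fixed primitive element $\omega$ of $\mathbb{F}_q$, the generalised Paley graph $\mathrm{GPaley}(q,\frac{q-1}{k})$ is the Cayley graph $\mathrm{Cay}(V,S)$ of the additive group of $V$ with connection set $S=\{1,\omega^k,\omega^{2k},\dots,\omega^{q-1-k}\}$: its vertex set is $V$ and $\{u,v\}$ is an edge iff $v-u\in S$ (an undirected graph since $S=-S$). *)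

theory Defs
  imports
    "HOL-Algebra.Subrings"
    "HOL-Algebra.Multiplicative_Group"
    "HOL-Computational_Algebra.Primes"
    "Graph_Theory.Graph_Theory"
begin

definition primitive_element :: "('a, 'b) ring_scheme \<Rightarrow> 'a \<Rightarrow> bool" where
  "primitive_element F w \<longleftrightarrow>
     w \<in> carrier (mult_of F) \<and> generate (mult_of F) {w} = carrier (mult_of F)"

lemma primitive_element_exists:
  assumes "field F" "finite (carrier F)"
  shows "\<exists>w. primitive_element F w"
proof -
  interpret field F by fact
  interpret M: group "mult_of F" by (rule field_mult_group)
  have fin: "finite (carrier (mult_of F))" using assms(2) by simp
  obtain w where w: "w \<in> carrier (mult_of F)"
    and "carrier (mult_of F) = {w [^]\<^bsub>F\<^esub> i | i :: nat. i \<in> UNIV}"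
    using finite_field_mult_group_has_gen[OF assms(2)] by blast
  then have "generate (mult_of F) {w} = carrier (mult_of F)"
    unfolding M.generate_pow_on_finite_carrier[OF fin w] by (simp add: nat_pow_mult_of)
  with w show ?thesis by (auto simp: primitive_element_def)
qed

text \<open>The Cayley graph of the additive group of \<open>F\<close>. As everywhere in \<open>Graph_Theory\<close>, an
  undirected edge is represented by its two arcs; the result is a graph if \<open>S\<close> is closed under
  negation and does not contain zero.\<close>

definition cayley_graph :: "('a, 'b) ring_scheme \<Rightarrow> 'a set \<Rightarrow> ('a, 'a \<times> 'a) pre_digraph" where
  "cayley_graph F S = with_proj
     \<lparr> pverts = carrier F,
       parcs = {(u, v). u \<in> carrier F \<and> v \<in> carrier F \<and> v \<ominus>\<^bsub>F\<^esub> u \<in> S} \<rparr>"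

definition gpaley_set :: "('a, 'b) ring_scheme \<Rightarrow> 'a \<Rightarrow> nat \<Rightarrow> 'a set" where
  "gpaley_set F w k = {w [^]\<^bsub>F\<^esub> (j * k) | j :: nat. True}"

text \<open>For a finite field \<open>F\<close> of order \<open>q\<close> with primitive element \<open>w\<close>, the graph \<open>gpaley F w k\<close> is
  GPaley$(q, (q-1)/k)$: the last argument is the index \<open>k\<close> of the connection set in the
  multiplicative group, not its size.\<close>

definition gpaley :: "('a, 'b) ring_scheme \<Rightarrow> 'a \<Rightarrow> nat \<Rightarrow> ('a, 'a \<times> 'a) pre_digraph" where
  "gpaley F w k = cayley_graph F (gpaley_set F w k)"

text \<open>Connected components are maximal connected subgraphs.\<close>

definition connected_component_of ::
    "('a, 'b) pre_digraph \<Rightarrow> ('a, 'b) pre_digraph \<Rightarrow> bool" where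
  "connected_component_of G C \<longleftrightarrow> pre_digraph.max_subgraph G connected C"

lemma gpaley_set_minus_one:
  assumes "field F" "finite (carrier F)" "primitive_element F w" "k dvd order F - 1"
    and ev: "odd (order F) \<Longrightarrow> even ((order F - 1) div k)"
  shows "\<ominus>\<^bsub>F\<^esub> \<one>\<^bsub>F\<^esub> \<in> gpaley_set F w k"
proof -
  interpret field F by fact
  interpret M: group "mult_of F" by (rule field_mult_group)
  have w: "w \<in> carrier (mult_of F)" and gen: "generate (mult_of F) {w} = carrier (mult_of F)"
    using assms(3) by (auto simp: primitive_element_def)
  have wF: "w \<in> carrier F" using w by simp
  have fin: "finite (carrier (mult_of F))" using assms(2) by simp
  have cardM: "card (carrier (mult_of F)) = order F - 1"
    using assms(2) by (simp add: order_def)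
  have ordw: "M.ord w = order F - 1"
    using M.generate_pow_card[OF w] gen cardM by simp
  have m1: "\<ominus>\<^bsub>F\<^esub> \<one>\<^bsub>F\<^esub> \<in> carrier (mult_of F)"
    using add.inv_eq_1_iff[of "\<one>\<^bsub>F\<^esub>"] by (simp add: a_inv_def)
  have sq: "(\<ominus>\<^bsub>F\<^esub> \<one>\<^bsub>F\<^esub>) [^]\<^bsub>F\<^esub> (2::nat) = \<one>\<^bsub>F\<^esub>"
    by (simp add: numeral_2_eq_2 l_minus)
  have "\<ominus>\<^bsub>F\<^esub> \<one>\<^bsub>F\<^esub> \<in> generate (mult_of F) {w}" using m1 gen by simp
  then obtain i :: nat where i: "\<ominus>\<^bsub>F\<^esub> \<one>\<^bsub>F\<^esub> = w [^]\<^bsub>F\<^esub> i"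
    unfolding M.generate_pow_on_finite_carrier[OF fin w] by (auto simp: nat_pow_mult_of)
  have "w [^]\<^bsub>F\<^esub> (i * 2) = \<one>\<^bsub>F\<^esub>"
    using sq unfolding i by (simp add: nat_pow_pow wF)
  then have d: "order F - 1 dvd i * 2"
    using M.pow_eq_id[OF w, of "i * 2"] ordw by (simp add: nat_pow_mult_of)
  obtain m where m: "order F - 1 = k * m" using assms(4) by (auto simp: dvd_def)
  have pos: "order F - 1 > 0" unfolding cardM[symmetric] card_gt_0_iff using w fin by blast
  have "k dvd i"
  proof (cases "odd (order F)")
    case True
    have "k > 0" using m pos by (cases k) auto
    then obtain n where "m = 2 * n" using ev[OF True] m by (auto simp: dvd_def)
    then have "2 * (k * n) dvd 2 * i" using d m by (simp add: ac_simps)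
    then have "k * n dvd i" by simp
    then show ?thesis by (rule dvd_mult_left)
  next
    case False
    then have "odd (order F - 1)" using pos by simp
    then have "coprime (order F - 1) 2" by (simp add: coprime_commute)
    then have "order F - 1 dvd i" using d by (simp add: coprime_dvd_mult_left_iff)
    then show ?thesis using assms(4) dvd_trans by blast
  qed
  then show ?thesis using i by (auto simp: gpaley_set_def dvd_def mult.commute)
qed

lemma graph_gpaley:
  assumes "field F" "finite (carrier F)" "primitive_element F w" "k dvd order F - 1"
    and "odd (order F) \<Longrightarrow> even ((order F - 1) div k)"
  shows "graph (gpaley F w k)"
proof -
  interpret field F by fact
  let ?S = "gpaley_set F w k"
  have w: "w \<in> carrier F" "w \<noteq> \<zero>\<^bsub>F\<^esub>" using assms(3) by (auto simp: primitive_element_def)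
  have z: "\<zero>\<^bsub>F\<^esub> \<notin> ?S"
  proof
    assume "\<zero>\<^bsub>F\<^esub> \<in> ?S"
    then obtain j :: nat where "w [^]\<^bsub>F\<^esub> (j * k) = \<zero>\<^bsub>F\<^esub>" by (auto simp: gpaley_set_def)
    moreover have "w \<in> Units F" using w field_Units by simp
    then have "w [^]\<^bsub>F\<^esub> (j * k) \<in> Units F" by (rule Units_pow_closed)
    ultimately show False using field_Units by simp
  qed
  obtain i :: nat where i: "\<ominus>\<^bsub>F\<^esub> \<one>\<^bsub>F\<^esub> = w [^]\<^bsub>F\<^esub> (i * k)"
    using gpaley_set_minus_one[OF assms] by (auto simp: gpaley_set_def)
  have neg: "\<ominus>\<^bsub>F\<^esub> x \<in> ?S" if x: "x \<in> ?S" for x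
  proof -
    obtain j :: nat where j: "x = w [^]\<^bsub>F\<^esub> (j * k)" using x by (auto simp: gpaley_set_def)
    have "\<ominus>\<^bsub>F\<^esub> x = (\<ominus>\<^bsub>F\<^esub> \<one>\<^bsub>F\<^esub>) \<otimes>\<^bsub>F\<^esub> x" using w by (simp add: j l_minus)
    also have "\<dots> = w [^]\<^bsub>F\<^esub> ((i + j) * k)" using w by (simp add: i j nat_pow_mult distrib_right)
    finally show ?thesis unfolding gpaley_set_def by blast
  qed
  have sw: "u \<ominus>\<^bsub>F\<^esub> v = \<ominus>\<^bsub>F\<^esub> (v \<ominus>\<^bsub>F\<^esub> u)" if "u \<in> carrier F" "v \<in> carrier F" for u v
    using that by (simp add: a_minus_def minus_add add.m_comm)
  have "finite {(u, v). u \<in> carrier F \<and> v \<in> carrier F \<and> v \<ominus>\<^bsub>F\<^esub> u \<in> ?S}"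
    by (rule finite_subset[of _ "carrier F \<times> carrier F"]) (use assms(2) in auto)
  moreover have "v \<ominus>\<^bsub>F\<^esub> u \<in> ?S \<Longrightarrow> u \<ominus>\<^bsub>F\<^esub> v \<in> ?S" if "u \<in> carrier F" "v \<in> carrier F" for u v
    using sw[OF that] neg by simp
  ultimately show ?thesis
    using assms(2) z
    by unfold_locales
      (auto simp: gpaley_def cayley_graph_def arc_to_ends_def symmetric_def sym_def
        a_minus_def r_neg)
qed

end

theory Submission
  imports Defs
begin

text \<open>The connected component \<open>K\<close> of zero is the additive subgroup generated by \<open>S\<close>. Since \<open>S\<close> is
  a multiplicative subgroup, \<open>K\<close> is closed under multiplication, and being finite it is a subfield,
  proper because the graph is disconnected. Translations carry \<open>K\<close> to every other component. The
  arithmetic relations between \<open>k\<close> and \<open>k'\<close> follow because \<open>S\<close> is the group of \<open>m\<close>-th roots of unity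
  in \<open>F\<close> as well as in \<open>K\<close>, where \<open>m = (p\<^sup>R - 1) / k\<close>.\<close>

section \<open>Divisibility among numbers of the form \<open>p ^ n - 1\<close>\<close>

text \<open>Euclidean descent on exponents: modulo \<open>p ^ a - 1\<close> the numbers
  \<open>p ^ n - 1\<close> and \<open>p ^ (n - a) - 1\<close> agree. Once \<open>n < a\<close>, size
  forces \<open>p ^ n - 1 = 0\<close>, hence \<open>n = 0\<close>.\<close>

lemma dvd_exponent_if_pow_diff_one_dvd:
  fixes p a n :: nat
  assumes p: "p \<ge> 2" and a: "a > 0" and d: "p ^ a - 1 dvd p ^ n - 1"
  shows "a dvd n"
  using d
proof (induction n rule: less_induct)
  case (less n)
  show ?case
  proof (cases "n < a")
    case True
    then have "p ^ n < p ^ a" using p by (simp add: power_strict_increasing)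
    moreover have "p ^ n \<ge> 1" using p by simp
    ultimately have "p ^ n - 1 < p ^ a - 1" by linarith
    then have "p ^ n - 1 = 0" using less.prems by (meson dvd_imp_le leD neq0_conv)
    then have "p ^ n = 1" using p \<open>p ^ n \<ge> 1\<close> by linarith
    then have "n = 0" using p by simp
    then show ?thesis by simp
  next
    case False
    have split: "p ^ n - 1 = p ^ (n - a) * (p ^ a - 1) + (p ^ (n - a) - 1)"
    proof -
      have "p ^ (n - a) * p ^ a = p ^ n" using False by (simp flip: power_add)
      \<comment> \<open>These bounds keep the truncated subtractions exact.\<close>
      moreover have "p ^ (n - a) \<ge> 1" "p ^ (n - a) \<le> p ^ n"
        using p by (auto intro: power_increasing)
      ultimately show ?thesis by (simp add: diff_mult_distrib2)
    qed
    then have "p ^ a - 1 dvd p ^ (n - a) - 1"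
      using less.prems by (metis dvd_add_right_iff dvd_triv_right)
    then have "a dvd n - a" using less.IH[of "n - a"] a False by simp
    then show ?thesis using False by (simp add: dvd_diff_nat dvd_minus_self)
  qed
qed

section \<open>Connected components of symmetric digraphs\<close>

text \<open>For any vertex \<open>u\<close> of \<open>C\<close>, the vertices reachable from
  \<open>u\<close> induce a connected subgraph that contains \<open>C\<close>, so maximality gives
  equality. This turns maximality into reachability, which translations respect.\<close>

lemma (in sym_digraph) max_connected_subgraph_eq_induce_reachable:
  assumes "max_subgraph connected C"
  obtains u where "u \<in> verts G" "C = G \<restriction> {v. u \<rightarrow>\<^sup>* v}"
proof -
  have sub: "subgraph C G" and con: "connected C"
    and mx: "\<And>H. subgraph C H \<Longrightarrow> subgraph H G \<Longrightarrow> connected H \<Longrightarrow> H = C"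
    using assms unfolding max_subgraph_def by blast+
  obtain u where u: "u \<in> verts C"
    using con by (auto simp: connected_def strongly_connected_def)
  have uG: "u \<in> verts G" using u sub by auto
  let ?H = "G \<restriction> {v. u \<rightarrow>\<^sup>* v}"
  have "u \<rightarrow>\<^sup>* v" if "v \<in> verts C" for v
  proof -
    have "u \<rightarrow>\<^sup>*\<^bsub>mk_symmetric C\<^esub> v"
      using con u that by (auto simp: connected_def strongly_connected_def)
    then have "u \<rightarrow>\<^sup>*\<^bsub>mk_symmetric G\<^esub> v"
      by (rule pre_digraph.reachable_mono[OF _ subgraph_mk_symmetric[OF sub]])
    then show ?thesis using reachable_mk_symmetric_eq[OF sym_arcs] by simp
  qed
  then have "verts C \<subseteq> {v. u \<rightarrow>\<^sup>* v}" by blast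
  then have "subgraph C ?H"
    using subgraph_induce_subgraphI2[OF sub] wellformed_induce_subgraph
    by (auto simp: subgraph_def compatible_def)
  moreover have scc: "?H \<in> sccs" by (rule induce_reachable_is_in_sccs[OF uG])
  then have ind: "induced_subgraph ?H G" and sc: "strongly_connected ?H" by auto
  \<comment> \<open>\<open>connected\<close> means that \<open>mk_symmetric ?H\<close> is strongly
    connected; for symmetric \<open>?H\<close> reachability is the same in both graphs.\<close>
  have "symmetric ?H" using induced_graph_imp_symmetric[OF sym_arcs ind] .
  then have "connected ?H"
    using sc wf_digraph.reachable_mk_symmetric_eq[OF wf_digraphI_induced[OF ind]]
    by (auto simp: connected_def strongly_connected_def)
  ultimately have "?H = C" using mx induced_imp_subgraph[OF ind] by blast
  then show ?thesis using that uG by blast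
qed

section \<open>Translation and scaling in Cayley graphs of rings\<close>

text \<open>Additive inverses are chosen inside the carrier, so they could change when it shrinks;
  in a subgroup they do not. This lets arcs over \<open>K\<close> be compared with arcs over
  \<open>R\<close>.\<close>

lemma (in ring) minus_subring_eq:
  assumes "subring K R" "x \<in> K" "y \<in> K"
  shows "y \<ominus>\<^bsub>R\<lparr>carrier := K\<rparr>\<^esub> x = y \<ominus> x"
proof -
  have "inv\<^bsub>(add_monoid R)\<lparr>carrier := K\<rparr>\<^esub> x = inv\<^bsub>add_monoid R\<^esub> x"
    by (rule group.m_inv_consistent[OF add.is_group subring.axioms(1)[OF assms(1)] assms(2)])
  then show ?thesis by (simp add: a_minus_def a_inv_def)
qed

lemma cayley_graph_simps:
  "verts (cayley_graph F S) = carrier F"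
  "arcs (cayley_graph F S) = {(u, v). u \<in> carrier F \<and> v \<in> carrier F \<and> v \<ominus>\<^bsub>F\<^esub> u \<in> S}"
  "arcs_ends (cayley_graph F S) = {(u, v). u \<in> carrier F \<and> v \<in> carrier F \<and> v \<ominus>\<^bsub>F\<^esub> u \<in> S}"
  "tail (cayley_graph F S) = fst" "head (cayley_graph F S) = snd"
  by (simp_all add: cayley_graph_def)

lemma wf_digraph_cayley_graph: "wf_digraph (cayley_graph F S)"
  by unfold_locales (auto simp: cayley_graph_simps)

text \<open>Arcs depend only on the difference of their ends, which a common shift
  preserves.\<close>

lemma (in ring) cayley_reachable_translate:
  assumes "u \<rightarrow>\<^sup>*\<^bsub>cayley_graph R S\<^esub> v" "x \<in> carrier R"
  shows "(u \<oplus> x) \<rightarrow>\<^sup>*\<^bsub>cayley_graph R S\<^esub> (v \<oplus> x)"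
proof -
  interpret G: wf_digraph "cayley_graph R S" by (rule wf_digraph_cayley_graph)
  show ?thesis using assms(1)
  proof (induction rule: G.reachable_induct)
    case base
    then show ?case using assms(2) by (auto simp: cayley_graph_simps)
  next
    case (step y z)
    then have yz: "y \<in> carrier R" "z \<in> carrier R" "z \<ominus> y \<in> S" by (auto simp: cayley_graph_simps)
    have "(z \<oplus> x) \<ominus> (y \<oplus> x) = z \<ominus> y" using yz assms(2) by algebra
    then have "(y \<oplus> x) \<rightarrow>\<^bsub>cayley_graph R S\<^esub> (z \<oplus> x)"
      using yz assms(2) by (simp add: cayley_graph_simps)
    with step.IH show ?case by (rule G.reachable_adj_trans)
  qed
qed

lemma (in ring) cayley_reachable_iff:
  assumes "u \<in> carrier R" "v \<in> carrier R"
  shows "u \<rightarrow>\<^sup>*\<^bsub>cayley_graph R S\<^esub> v \<longleftrightarrow> \<zero> \<rightarrow>\<^sup>*\<^bsub>cayley_graph R S\<^esub> (v \<ominus> u)"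
proof
  assume "u \<rightarrow>\<^sup>*\<^bsub>cayley_graph R S\<^esub> v"
  from cayley_reachable_translate[OF this, of "\<ominus> u"] show "\<zero> \<rightarrow>\<^sup>*\<^bsub>cayley_graph R S\<^esub> (v \<ominus> u)"
    using assms by (simp add: r_neg a_minus_def)
next
  assume "\<zero> \<rightarrow>\<^sup>*\<^bsub>cayley_graph R S\<^esub> (v \<ominus> u)"
  from cayley_reachable_translate[OF this, of u] show "u \<rightarrow>\<^sup>*\<^bsub>cayley_graph R S\<^esub> v"
    using assms by (simp add: a_minus_def a_assoc l_neg)
qed

text \<open>Multiplying a walk by \<open>x\<close> multiplies each of its differences by
  \<open>x\<close>, and these stay in \<open>S\<close>.\<close>

lemma (in ring) cayley_reachable_scale:
  assumes "u \<rightarrow>\<^sup>*\<^bsub>cayley_graph R S\<^esub> v" "x \<in> carrier R" "\<And>s. s \<in> S \<Longrightarrow> x \<otimes> s \<in> S"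
  shows "(x \<otimes> u) \<rightarrow>\<^sup>*\<^bsub>cayley_graph R S\<^esub> (x \<otimes> v)"
proof -
  interpret G: wf_digraph "cayley_graph R S" by (rule wf_digraph_cayley_graph)
  show ?thesis using assms(1)
  proof (induction rule: G.reachable_induct)
    case base
    then show ?case using assms(2) by (auto simp: cayley_graph_simps)
  next
    case (step y z)
    then have yz: "y \<in> carrier R" "z \<in> carrier R" "z \<ominus> y \<in> S" by (auto simp: cayley_graph_simps)
    have "x \<otimes> z \<ominus> x \<otimes> y = x \<otimes> (z \<ominus> y)" using yz assms(2) by algebra
    then have "(x \<otimes> y) \<rightarrow>\<^bsub>cayley_graph R S\<^esub> (x \<otimes> z)"
      using yz assms(2,3) by (simp add: cayley_graph_simps)
    with step.IH show ?case by (rule G.reachable_adj_trans)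
  qed
qed

section \<open>Ring structure on the component of zero\<close>

text \<open>Sums come from concatenating translated walks. Closure of \<open>S\<close> under
  products makes the component stable under scaling by \<open>S\<close>, and distributivity along a
  walk extends this to all products. Negatives are the scalings by
  \<open>\<ominus> \<one>\<close>.\<close>

lemma (in cring) subring_cayley_component:
  assumes sub: "S \<subseteq> carrier R" and one: "\<one> \<in> S" and m1: "\<ominus> \<one> \<in> S"
    and mult: "\<And>s t. s \<in> S \<Longrightarrow> t \<in> S \<Longrightarrow> s \<otimes> t \<in> S"
  shows "subring {x. \<zero> \<rightarrow>\<^sup>*\<^bsub>cayley_graph R S\<^esub> x} R"
proof -
  let ?G = "cayley_graph R S"
  interpret G: wf_digraph ?G by (rule wf_digraph_cayley_graph)
  have car: "x \<in> carrier R" if "\<zero> \<rightarrow>\<^sup>*\<^bsub>?G\<^esub> x" for x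
    using G.reachable_in_verts[OF that] by (simp add: cayley_graph_simps)
  have gen: "\<zero> \<rightarrow>\<^sup>*\<^bsub>?G\<^esub> s" if "s \<in> S" for s
  proof -
    have "s \<in> carrier R" using that sub by blast
    then have "\<zero> \<rightarrow>\<^bsub>?G\<^esub> s" using that by (simp add: cayley_graph_simps a_minus_def)
    then show ?thesis by (rule G.reachable_adjI)
  qed
  \<comment> \<open>Translate the walk to \<open>x\<close> by \<open>y\<close> and append it to the
    walk to \<open>y\<close>.\<close>
  have add: "\<zero> \<rightarrow>\<^sup>*\<^bsub>?G\<^esub> (x \<oplus> y)" if "\<zero> \<rightarrow>\<^sup>*\<^bsub>?G\<^esub> x" "\<zero> \<rightarrow>\<^sup>*\<^bsub>?G\<^esub> y" for x y
  proof -
    have "y \<rightarrow>\<^sup>*\<^bsub>?G\<^esub> (x \<oplus> y)"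
      using cayley_reachable_translate[OF that(1) car[OF that(2)]] car[OF that(2)] by simp
    with that(2) show ?thesis by (rule G.reachable_trans)
  qed
  have smult: "\<zero> \<rightarrow>\<^sup>*\<^bsub>?G\<^esub> (s \<otimes> x)" if s: "s \<in> S" and x: "\<zero> \<rightarrow>\<^sup>*\<^bsub>?G\<^esub> x" for s x
    using cayley_reachable_scale[OF x, of s] s sub mult by auto
  \<comment> \<open>Follow the walk to \<open>x\<close>: each arc from \<open>a\<close> to
    \<open>b\<close> adds \<open>(b \<ominus> a) \<otimes> y\<close>, an \<open>S\<close>-multiple
    of \<open>y\<close>.\<close>
  have times: "\<zero> \<rightarrow>\<^sup>*\<^bsub>?G\<^esub> (x \<otimes> y)" if x: "\<zero> \<rightarrow>\<^sup>*\<^bsub>?G\<^esub> x" and y: "\<zero> \<rightarrow>\<^sup>*\<^bsub>?G\<^esub> y" for x y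
    using x
  proof (induction rule: G.reachable_induct)
    case base
    then show ?case using car[OF y] by (simp add: cayley_graph_simps)
  next
    case (step a b)
    then have ab: "a \<in> carrier R" "b \<in> carrier R" "b \<ominus> a \<in> S" by (auto simp: cayley_graph_simps)
    have "b \<otimes> y = a \<otimes> y \<oplus> (b \<ominus> a) \<otimes> y" using ab car[OF y] by algebra
    then show ?case using add[OF step.IH smult[OF ab(3) y]] by simp
  qed
  show ?thesis
  proof (rule subringI)
    fix h assume "h \<in> {x. \<zero> \<rightarrow>\<^sup>*\<^bsub>?G\<^esub> x}"
    then have h: "\<zero> \<rightarrow>\<^sup>*\<^bsub>?G\<^esub> h" by simp
    have "\<ominus> \<one> \<otimes> h = \<ominus> h" using car[OF h] by algebra
    then show "\<ominus> h \<in> {x. \<zero> \<rightarrow>\<^sup>*\<^bsub>?G\<^esub> x}" using smult[OF m1 h] by simp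
  qed (use car gen one add times in auto)
qed

text \<open>Multiplication by a nonzero \<open>x\<close> is injective on the finite set
  \<open>K\<close>, hence onto, so it hits \<open>\<one>\<close>.\<close>

lemma (in field) finite_subring_is_subfield:
  assumes "subring K R" "finite K"
  shows "subfield K R"
proof (rule subfieldI'[OF assms(1)])
  fix x assume x: "x \<in> K - {\<zero>}"
  note K = subringE[OF assms(1)]
  have xR: "x \<in> carrier R" "x \<noteq> \<zero>" using x K(1) by auto
  have "inj_on ((\<otimes>) x) K"
    using xR K(1) by (auto intro!: inj_onI simp: m_lcancel subset_eq)
  moreover have "(\<otimes>) x ` K \<subseteq> K" using x K(6) by auto
  ultimately have "(\<otimes>) x ` K = K" using assms(2) by (simp add: endo_inj_surj)
  then obtain y where y: "y \<in> K" "x \<otimes> y = \<one>" using K(3) by (metis imageE)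
  then have "inv x = y" using xR K(1) by (intro comm_inv_char) auto
  then show "inv x \<in> K" using y by simp
qed

section \<open>Isomorphism between components\<close>

text \<open>Subtracting \<open>u\<close> carries the component of \<open>u\<close> onto
  \<open>K\<close> and preserves all differences, hence arcs in both directions.\<close>

lemma (in ring) digraph_iso_cayley_component:
  fixes S
  defines "K \<equiv> {x. \<zero> \<rightarrow>\<^sup>*\<^bsub>cayley_graph R S\<^esub> x}"
  assumes K: "subring K R" and u: "u \<in> carrier R"
  shows "digraph_iso (cayley_graph R S \<restriction> {v. u \<rightarrow>\<^sup>*\<^bsub>cayley_graph R S\<^esub> v})
           (cayley_graph (R\<lparr>carrier := K\<rparr>) S)"
proof -
  let ?G = "cayley_graph R S" and ?K = "R\<lparr>carrier := K\<rparr>"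
  define W where "W = {v. u \<rightarrow>\<^sup>*\<^bsub>?G\<^esub> v}"
  let ?C = "?G \<restriction> W"
  let ?f = "\<lambda>x. x \<ominus> u"
  \<comment> \<open>Arcs are pairs with the projections as tail and head, so the translation acts on
    both coordinates.\<close>
  let ?h = "\<lparr>iso_verts = ?f, iso_arcs = map_prod ?f ?f, iso_head = snd, iso_tail = fst\<rparr>"
  have KR: "K \<subseteq> carrier R" by (rule subringE(1)[OF K])
  have V: "v \<in> W \<longleftrightarrow> v \<in> carrier R \<and> ?f v \<in> K" for v
  proof -
    have "v \<in> carrier R" if "u \<rightarrow>\<^sup>*\<^bsub>?G\<^esub> v"
      using wf_digraph.reachable_in_verts(2)[OF wf_digraph_cayley_graph that] by (simp add: cayley_graph_simps)
    then show ?thesis unfolding W_def K_def mem_Collect_eq using cayley_reachable_iff[OF u] by metis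
  qed
  have inj: "inj_on ?f (carrier R)"
    using u by (auto intro!: inj_onI simp: a_minus_def)
  have fx: "x \<oplus> u \<in> carrier R" "?f (x \<oplus> u) = x" if "x \<in> K" for x
    using that u KR by (auto simp: a_minus_def a_assoc r_neg subset_eq)
  have diff: "?f y \<ominus> ?f x = y \<ominus> x" if "x \<in> carrier R" "y \<in> carrier R" for x y
    using that u by algebra
  have verts: "?f ` W = K"
  proof
    show "K \<subseteq> ?f ` W"
    proof
      fix x assume "x \<in> K"
      then show "x \<in> ?f ` W" using fx[of x] V[of "x \<oplus> u"] by (metis imageI)
    qed
  qed (use V in blast)
  have arcsC: "arcs ?C = {(x, y). x \<in> carrier R \<and> y \<in> carrier R \<and> ?f x \<in> K \<and> ?f y \<in> K \<and> y \<ominus> x \<in> S}"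
    unfolding induce_subgraph_arcs cayley_graph_simps V by auto
  have arcsK: "arcs (cayley_graph ?K S) = {(x, y). x \<in> K \<and> y \<in> K \<and> y \<ominus> x \<in> S}"
    unfolding cayley_graph_simps using minus_subring_eq[OF K] by auto
  have arcs: "map_prod ?f ?f ` arcs ?C = arcs (cayley_graph ?K S)"
  proof
    show "map_prod ?f ?f ` arcs ?C \<subseteq> arcs (cayley_graph ?K S)"
      unfolding arcsC arcsK using diff by auto
    show "arcs (cayley_graph ?K S) \<subseteq> map_prod ?f ?f ` arcs ?C"
    proof
      fix e assume "e \<in> arcs (cayley_graph ?K S)"
      then obtain x y where e: "e = (x, y)" and xy: "x \<in> K" "y \<in> K" "y \<ominus> x \<in> S"
        unfolding arcsK by auto
      have "(y \<oplus> u) \<ominus> (x \<oplus> u) = y \<ominus> x" using diff[of "x \<oplus> u" "y \<oplus> u"] fx xy by simp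
      then have "(x \<oplus> u, y \<oplus> u) \<in> arcs ?C" unfolding arcsC using xy fx by simp
      moreover have "map_prod ?f ?f (x \<oplus> u, y \<oplus> u) = e" using fx xy e by simp
      ultimately show "e \<in> map_prod ?f ?f ` arcs ?C" by (metis imageI)
    qed
  qed
  have "pre_digraph.digraph_isomorphism ?C ?h"
    unfolding pre_digraph.digraph_isomorphism_def
  proof (intro conjI ballI)
    show "wf_digraph ?C" by (rule wf_digraph.wellformed_induce_subgraph[OF wf_digraph_cayley_graph])
    show "inj_on (iso_verts ?h) (verts ?C)"
      using V by (auto intro!: inj_on_subset[OF inj])
    have "inj_on (map_prod ?f ?f) (carrier R \<times> carrier R)"
      by (rule map_prod_inj_on[OF inj inj])
    then show "inj_on (iso_arcs ?h) (arcs ?C)"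
      by (auto simp: cayley_graph_simps elim: inj_on_subset)
  qed (auto simp: cayley_graph_simps)
  moreover have "cayley_graph ?K S = app_iso ?h ?C"
    by (rule pre_digraph.equality)
      (use verts arcs in \<open>simp_all add: cayley_graph_simps\<close>)
  ultimately show ?thesis unfolding digraph_iso_def W_def by blast
qed

section \<open>Roots of unity and orders of subfields\<close>

lemma (in field) pow_primitive_element_eq_one_iff:
  assumes "primitive_element R w" "finite (carrier R)"
  shows "w [^] (n :: nat) = \<one> \<longleftrightarrow> order R - 1 dvd n"
proof -
  interpret M: group "mult_of R" by (rule field_mult_group)
  have w: "w \<in> carrier (mult_of R)" and gen: "generate (mult_of R) {w} = carrier (mult_of R)"
    using assms(1) by (auto simp: primitive_element_def)
  have "M.ord w = order R - 1"
    using M.generate_pow_card[OF w] gen assms(2) by (simp add: order_def)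
  then show ?thesis using M.pow_eq_id[OF w, of n] by (simp add: nat_pow_mult_of)
qed

text \<open>Writing \<open>x = w [^] i\<close>, the equation \<open>x [^] m = \<one>\<close> says
  that \<open>k * m\<close> divides \<open>i * m\<close>, that is, \<open>k\<close> divides
  \<open>i\<close>. The right-hand side does not mention \<open>w\<close>, so connection sets in
  \<open>F\<close> and in a subfield become comparable.\<close>

lemma (in field) gpaley_set_eq_roots_of_unity:
  assumes w: "primitive_element R w" and fin: "finite (carrier R)" and k: "k * m = order R - 1"
    and m: "m > 0"
  shows "gpaley_set R w k = {x \<in> carrier R. x [^] m = \<one>}"
proof
  interpret M: group "mult_of R" by (rule field_mult_group)
  have wM: "w \<in> carrier (mult_of R)" and gen: "generate (mult_of R) {w} = carrier (mult_of R)"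
    using w by (auto simp: primitive_element_def)
  have wR: "w \<in> carrier R" using wM by simp
  note pow = pow_primitive_element_eq_one_iff[OF w fin]
  show "gpaley_set R w k \<subseteq> {x \<in> carrier R. x [^] m = \<one>}"
    using wR pow k by (auto simp: gpaley_set_def nat_pow_pow mult.assoc)
  show "{x \<in> carrier R. x [^] m = \<one>} \<subseteq> gpaley_set R w k"
  proof
    fix x assume x: "x \<in> {x \<in> carrier R. x [^] m = \<one>}"
    then have "x \<noteq> \<zero>" using m by (auto simp: nat_pow_zero)
    then have "x \<in> generate (mult_of R) {w}" using x gen by simp
    then obtain i :: nat where i: "x = w [^] i"
      using M.generate_pow_on_finite_carrier[OF _ wM] fin by (auto simp: nat_pow_mult_of)
    have "k * m dvd i * m" using x pow[of "i * m"] k i wR by (simp add: nat_pow_pow)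
    then have "k dvd i" using m by simp
    then show "x \<in> gpaley_set R w k" using i by (auto simp: gpaley_set_def dvd_def mult.commute)
  qed
qed

text \<open>Lagrange is applied twice: the additive group makes \<open>card K\<close> a power of
  \<open>p\<close>, and the multiplicative group gives the divisibility that yields
  \<open>a dvd n\<close>.\<close>

lemma (in field) card_subfield_prime_power:
  assumes K: "subfield K R" and p: "prime p" and ord: "order R = p ^ n"
  obtains a where "a > 0" "card K = p ^ a" "a dvd n" "p ^ a - 1 dvd p ^ n - 1"
proof -
  have fin: "finite (carrier R)"
    using ord p prime_gt_0_nat by (metis card.infinite order_def power_not_zero less_numeral_extra(3))
  have finK: "finite K" using fin subfieldE(3)[OF K] finite_subset by blast
  have "card K dvd p ^ n"
    using add.lagrange[OF subring.axioms(1)[OF subfieldE(1)[OF K]]] ord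
    by (simp add: order_def) (metis dvd_triv_right)
  then obtain a where a: "card K = p ^ a" using divides_primepow_nat[OF p] by blast
  \<comment> \<open>Two distinct elements rule out \<open>a = 0\<close>.\<close>
  have "{\<zero>, \<one>} \<subseteq> K" using subringE(2,3)[OF subfieldE(1)[OF K]] by simp
  then have "card {\<zero>, \<one>} \<le> card K" using finK by (rule card_mono[rotated])
  then have "card K \<ge> 2" by simp
  then have a0: "a > 0" using a by (cases a) auto
  interpret M: group "mult_of R" by (rule field_mult_group)
  have "card (K - {\<zero>}) dvd order (mult_of R)"
    using M.lagrange[OF subgroup_mult_of[OF K]] by (metis dvd_triv_right)
  moreover have "card (K - {\<zero>}) = p ^ a - 1"
    using a subringE(2)[OF subfieldE(1)[OF K]] finK by simp
  moreover have "order (mult_of R) = p ^ n - 1"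
    using ord fin by (simp add: order_def)
  ultimately have d: "p ^ a - 1 dvd p ^ n - 1" by simp
  have "a dvd n"
    by (rule dvd_exponent_if_pow_diff_one_dvd[OF prime_ge_2_nat[OF p] a0 d])
  then show ?thesis using that a0 a d by blast
qed

section \<open>Disconnected generalised Paley graphs\<close>

text \<open>Quantifying over all \<open>w'\<close> makes the description independent of the
  generator of the subfield; \<open>primitive_element_exists\<close> ensures that there is
  one.\<close>

theorem theorem3p4:
  fixes F :: "('a, 'b) ring_scheme" and w :: 'a and S :: "'a set"
    and G :: "('a, 'a \<times> 'a) pre_digraph" and p R k :: nat
  assumes "prime p" and "R \<ge> 1"
    and "field F" and "order F = p ^ R"
    and "k \<ge> 2" and "k dvd p ^ R - 1"
    and "odd p \<Longrightarrow> even ((p ^ R - 1) div k)"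
    and "primitive_element F w"
    and "S = gpaley_set F w k"
    and "G = gpaley F w k"
    and "\<not> connected G"
  shows "\<exists>a k' K.
      a dvd R \<and> a < R \<and>
      subfield K F \<and> card K = p ^ a \<and> S \<subseteq> K \<and>
      k = (p ^ R - 1) div (p ^ a - 1) * k' \<and>
      k' dvd p ^ a - 1 \<and> (odd p \<longrightarrow> even ((p ^ a - 1) div k')) \<and>
      (\<forall>w'. primitive_element (F\<lparr>carrier := K\<rparr>) w' \<longrightarrow>
         gpaley (F\<lparr>carrier := K\<rparr>) w' k' = cayley_graph (F\<lparr>carrier := K\<rparr>) S) \<and>
      (\<forall>C. connected_component_of G C \<longrightarrow>
         digraph_iso C (cayley_graph (F\<lparr>carrier := K\<rparr>) S))"
proof -
  interpret field F by fact
  have p2: "p \<ge> 2" using assms(1) by (rule prime_ge_2_nat)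
  have q2: "p ^ R \<ge> 2" using self_le_power[of p R] p2 assms(2) by linarith
  have fin: "finite (carrier F)"
    using assms(4) q2 by (metis card.infinite not_numeral_le_zero order_def)
  \<comment> \<open>\<open>m\<close> is the order of the multiplicative group \<open>S\<close>, the
    valency of the graph.\<close>
  obtain m where km: "p ^ R - 1 = k * m" using assms(6) by (auto simp: dvd_def)
  have m0: "m > 0" using km q2 by (cases m) auto
  have m_eq: "(p ^ R - 1) div k = m" using km assms(5) by simp
  have odd_p: "odd p" if "odd (order F)" using that assms(2,4) by auto
  have G: "G = cayley_graph F S" using assms(9,10) by (simp add: gpaley_def)
  have m1: "\<ominus>\<^bsub>F\<^esub> \<one>\<^bsub>F\<^esub> \<in> S"
    unfolding assms(9) using assms fin odd_p by (intro gpaley_set_minus_one) auto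
  have "graph G"
    unfolding assms(10) using assms fin odd_p by (intro graph_gpaley) auto
  then interpret G: graph G .
  have wF: "w \<in> carrier F" using assms(8) by (simp add: primitive_element_def)
  have S: "S = {x \<in> carrier F. x [^]\<^bsub>F\<^esub> m = \<one>\<^bsub>F\<^esub>}"
    unfolding assms(9) using gpaley_set_eq_roots_of_unity[OF assms(8) fin _ m0] km assms(4) by simp
  define K where "K = {x. \<zero>\<^bsub>F\<^esub> \<rightarrow>\<^sup>*\<^bsub>cayley_graph F S\<^esub> x}"
  have K_sub: "subring K F"
    unfolding K_def using S m1
    by (intro subring_cayley_component) (auto simp: nat_pow_distrib)
  then have KF: "K \<subseteq> carrier F" by (rule subringE(1))
  then have finK: "finite K" using fin finite_subset by blast
  have K: "subfield K F" by (rule finite_subring_is_subfield[OF K_sub finK])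
  obtain a where a: "a > 0" "card K = p ^ a" "a dvd R" "p ^ a - 1 dvd p ^ R - 1"
    using card_subfield_prime_power[OF K assms(1,4)] .
  \<comment> \<open>Otherwise zero reaches every vertex, and by symmetry any two vertices reach each
    other through zero, against disconnectedness.\<close>
  have "K \<noteq> carrier F"
  proof
    assume "K = carrier F"
    then have r: "\<zero>\<^bsub>F\<^esub> \<rightarrow>\<^sup>*\<^bsub>G\<^esub> x" if "x \<in> verts G" for x
      using that unfolding K_def G by (auto simp: cayley_graph_simps)
    have "strongly_connected (mk_symmetric G)"
    proof (rule strongly_connectedI)
      show "verts (with_proj (mk_symmetric G)) \<noteq> {}" by (auto simp: G cayley_graph_simps)
      fix x y assume "x \<in> verts (with_proj (mk_symmetric G))"
        and "y \<in> verts (with_proj (mk_symmetric G))"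
      then have "x \<rightarrow>\<^sup>*\<^bsub>G\<^esub> y"
        using r G.symmetric_reachable' G.reachable_trans
        by (metis with_proj_simps(1) pverts_mk_symmetric)
      then show "x \<rightarrow>\<^sup>*\<^bsub>mk_symmetric G\<^esub> y" by (rule G.reachable_mk_symmetricI)
    qed
    then show False using assms(11) by (simp add: connected_def)
  qed
  then have "card K < card (carrier F)" using KF fin by (simp add: psubset_card_mono psubset_eq)
  then have "p ^ a < p ^ R" using a(2) assms(4) by (simp add: order_def)
  then have aR: "a < R" using p2 by (simp add: power_strict_increasing_iff)
  have SK: "S \<subseteq> K"
  proof
    fix s assume "s \<in> S"
    then have "\<zero>\<^bsub>F\<^esub> \<rightarrow>\<^bsub>G\<^esub> s" using S by (simp add: G cayley_graph_simps a_minus_def)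
    then show "s \<in> K" unfolding K_def using G G.reachable_adjI by auto
  qed
  interpret K: field "F\<lparr>carrier := K\<rparr>" by (rule subfield_iff(2)[OF K])
  have ordK: "order (F\<lparr>carrier := K\<rparr>) = p ^ a" using a(2) by (simp add: order_def)
  \<comment> \<open>Natural powers are built from multiplication and one alone, so they ignore the
    carrier.\<close>
  have powK: "x [^]\<^bsub>F\<lparr>carrier := K\<rparr>\<^esub> n = x [^]\<^bsub>F\<^esub> n" for x and n :: nat
    by (simp add: nat_pow_def)
  have pa: "p ^ a \<ge> 2" using self_le_power[of p a] p2 a(1) by linarith
  \<comment> \<open>The element \<open>w [^] k\<close> has order \<open>m\<close> and lies in the
    multiplicative group of \<open>K\<close>, which has order \<open>p ^ a - 1\<close>.\<close>
  have "m dvd p ^ a - 1"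
  proof -
    interpret MK: group "mult_of (F\<lparr>carrier := K\<rparr>)" by (rule K.field_mult_group)
    let ?x = "w [^]\<^bsub>F\<^esub> k"
    have "?x = w [^]\<^bsub>F\<^esub> (1 * k)" by simp
    then have "?x \<in> S" unfolding assms(9) gpaley_set_def by blast
    then have xK: "?x \<in> K" and "?x [^]\<^bsub>F\<^esub> m = \<one>\<^bsub>F\<^esub>" using S SK by auto
    then have "?x \<noteq> \<zero>\<^bsub>F\<^esub>" using m0 by (auto simp: nat_pow_zero)
    then have "?x [^]\<^bsub>mult_of (F\<lparr>carrier := K\<rparr>)\<^esub> order (mult_of (F\<lparr>carrier := K\<rparr>))
        = \<one>\<^bsub>mult_of (F\<lparr>carrier := K\<rparr>)\<^esub>"
      using xK by (intro MK.pow_order_eq_1) simp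
    moreover have "order (mult_of (F\<lparr>carrier := K\<rparr>)) = p ^ a - 1"
      using ordK finK subringE(2)[OF K_sub] by (simp add: order_def)
    ultimately have "?x [^]\<^bsub>F\<^esub> (p ^ a - 1) = \<one>\<^bsub>F\<^esub>" by (simp add: nat_pow_mult_of powK)
    then have "k * m dvd k * (p ^ a - 1)"
      using pow_primitive_element_eq_one_iff[OF assms(8) fin, of "k * (p ^ a - 1)"] wF km assms(4)
      by (simp add: nat_pow_pow)
    then show ?thesis using assms(5) by simp
  qed
  \<comment> \<open>\<open>k'\<close> is the index of \<open>S\<close> in the multiplicative group
    of \<open>K\<close>.\<close>
  then obtain k' where k': "p ^ a - 1 = m * k'" by (auto simp: dvd_def)
  have k'0: "k' > 0" using k' pa by (cases k') auto
  obtain c where c: "p ^ R - 1 = (p ^ a - 1) * c" using a(4) by (auto simp: dvd_def)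
  \<comment> \<open>Both sides equal \<open>p ^ R - 1\<close>; cancelling \<open>m\<close> gives the
    required factorisation of \<open>k\<close>.\<close>
  have "m * k = m * (c * k')" using c k' km by (metis mult.assoc mult.commute)
  then have "k = c * k'" using m0 by simp
  moreover have "(p ^ R - 1) div (p ^ a - 1) = c" using c pa by simp
  ultimately have k_eq: "k = (p ^ R - 1) div (p ^ a - 1) * k'" by simp
  \<comment> \<open>Both quotients equal \<open>m\<close>, so the parity hypothesis carries
    over.\<close>
  have ev: "even ((p ^ a - 1) div k')" if "odd p"
    using assms(7)[OF that] m_eq k' k'0 by simp
  \<comment> \<open>All \<open>m\<close>-th roots of unity of \<open>F\<close> already lie in
    \<open>K\<close>, so the connection set for any \<open>w'\<close> is again
    \<open>S\<close>.\<close>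
  have gp: "gpaley (F\<lparr>carrier := K\<rparr>) w' k' = cayley_graph (F\<lparr>carrier := K\<rparr>) S"
    if "primitive_element (F\<lparr>carrier := K\<rparr>) w'" for w'
  proof -
    have "gpaley_set (F\<lparr>carrier := K\<rparr>) w' k' = {x \<in> K. x [^]\<^bsub>F\<^esub> m = \<one>\<^bsub>F\<^esub>}"
      using K.gpaley_set_eq_roots_of_unity[OF that _ _ m0, of k'] finK ordK k'
      by (simp add: powK mult.commute)
    also have "\<dots> = S" using S SK KF by auto
    finally show ?thesis by (simp add: gpaley_def)
  qed
  have comp: "digraph_iso C (cayley_graph (F\<lparr>carrier := K\<rparr>) S)"
    if C: "connected_component_of G C" for C
  proof -
    obtain u where "u \<in> verts G" and Cu: "C = G \<restriction> {v. u \<rightarrow>\<^sup>*\<^bsub>G\<^esub> v}"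
      using G.max_connected_subgraph_eq_induce_reachable C
      unfolding connected_component_of_def by blast
    then have "u \<in> carrier F" by (simp add: G cayley_graph_simps)
    then show ?thesis
      using digraph_iso_cayley_component[of S u] K_sub unfolding Cu G K_def by blast
  qed
  show ?thesis
    using a aR K SK k_eq k' ev gp comp by (intro exI[of _ a] exI[of _ k'] exI[of _ K]) auto
qed

end
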